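(* Let $G$ be an analytic group. Then either all free subgroups of $G$ are countable or else $G$ contains a free subgroup generated by a perfect set (i.e. there is a perfect set $P\subseteq G$ such that the subgroup of $G$ generated by $P$ is a free group).
   Context: An analytic group is a Hausdorff topological group whose underlying topological space is analytic, i.e. a continuous image of a Polish (completely metrizable separable) space. A set is perfect if (with the subspace topology) it is nonempty, completely metrizable and has no isolated points. Free subgroups are free as abstract groups. *)

theory Defs
  imports "HOL-Analysis.Analysis" "HOL-Algebra.Generated_Groups"
begin

text \<open>Topological groups, Polish and analytic spaces\<close>

definition topological_group :: "('a, 'c) monoid_scheme \<Rightarrow> 'a topology \<Rightarrow> bool" where
  "topological_group G T \<longleftrightarrow>
     group G \<and> topspace T = carrier G \<and>
     continuous_map (prod_topology T T) T (\<lambda>(x, y). x \<otimes>\<^bsub>G\<^esub> y) \<and>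
     continuous_map T T (\<lambda>x. inv\<^bsub>G\<^esub> x)"

definition Polish_space :: "'a topology \<Rightarrow> bool" where
  "Polish_space X \<longleftrightarrow> completely_metrizable_space X \<and> separable_space X"

text \<open>One cannot quantify over the type carrying the Polish space, so the definition uses Polish
  spaces whose points are real numbers; their topology is arbitrary and need not be related to the
  usual one. A Polish space has at most continuum many points, so this is no restriction: see
  \<open>analytic_spaceI\<close> below.\<close>

definition analytic_space :: "'a topology \<Rightarrow> bool" where
  "analytic_space T \<longleftrightarrow>
     (\<exists>(X :: real topology) f. Polish_space X \<and> continuous_map X T f \<and> f ` topspace X = topspace T)"

lemma Polish_space_inj_real:
  assumes "Polish_space X"
  shows "\<exists>e :: 'b \<Rightarrow> real. inj_on e (topspace X)"
proof -
  from assms have cm: "completely_metrizable_space X" and sep: "separable_space X"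
    by (auto simp: Polish_space_def)
  from cm obtain M d where M: "Metric_space M d" and X: "X = Metric_space.mtopology M d"
    by (auto simp: completely_metrizable_space_def)
  interpret Metric_space M d by fact
  have top: "topspace X = M" by (simp add: X)
  from sep obtain D where D: "countable D" "D \<subseteq> M" "X closure_of D = M"
    by (auto simp: separable_space_def top)
  define g where "g = (\<lambda>x (n, q). d x (from_nat_into D n) < real_of_rat q)"
  have "inj_on g M"
  proof (rule inj_onI, rule ccontr)
    fix x y assume xy: "x \<in> M" "y \<in> M" "g x = g y" "x \<noteq> y"
    define r where "r = d x y / 2"
    have "r > 0" using xy by (simp add: r_def)
    moreover have "x \<in> X closure_of D" using D xy by simp
    ultimately obtain z where z: "z \<in> D" "z \<in> M" "d x z < r"
      by (auto simp: X metric_closure_of)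
    obtain n where n: "z = from_nat_into D n"
      using from_nat_into_surj[OF D(1) z(1)] by metis
    obtain q where q: "d x z < real_of_rat q" "real_of_rat q < r"
      using of_rat_dense z(3) by blast
    have "g x (n, q) = g y (n, q)" using xy(3) by simp
    then have "d y z < real_of_rat q" using q n by (simp add: g_def)
    then show False using triangle[of x z y] xy z q by (simp add: r_def commute)
  qed
  moreover define u where "u = (\<lambda>p :: (nat \<times> rat) \<Rightarrow> bool. to_nat ` Collect p)"
  have "inj u" by (auto simp: inj_def u_def inj_image_eq_iff)
  moreover obtain v :: "nat set \<Rightarrow> real" where "inj v"
    using nat_sets_lepoll_reals01 unfolding lepoll_def by blast
  ultimately have "inj_on (v \<circ> u \<circ> g) M"
    by (metis comp_inj_on inj_on_subset subset_UNIV)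
  then show ?thesis by (auto simp: top)
qed

lemma analytic_spaceI:
  fixes X :: "'b topology"
  assumes P: "Polish_space X" and f: "continuous_map X T f" "f ` topspace X = topspace T"
  shows "analytic_space T"
proof -
  obtain e :: "'b \<Rightarrow> real" where e: "inj_on e (topspace X)"
    using Polish_space_inj_real[OF P] by blast
  define i where "i = inv_into (topspace X) e"
  define Y where "Y = pullback_topology (e ` topspace X) i X"
  have topY: "topspace Y = e ` topspace X"
    by (auto simp: Y_def topspace_pullback_topology i_def e)
  have ie: "i (e x) = x" if "x \<in> topspace X" for x
    using that e by (simp add: i_def)
  have i: "continuous_map Y X i"
    using continuous_map_pullback[of X X id "e ` topspace X" i] by (simp add: Y_def)
  have "continuous_map X Y e"
    unfolding Y_def
    by (rule continuous_map_pullback') (auto intro: continuous_map_eq[of X X id] simp: ie)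
  with i have hm: "homeomorphic_maps X Y e i"
    by (auto simp: homeomorphic_maps_def topY ie)
  then have "X homeomorphic_space Y" by (auto simp: homeomorphic_space_def)
  then have "Polish_space Y"
    using P homeomorphic_completely_metrizable_space homeomorphic_separable_space
    by (auto simp: Polish_space_def)
  moreover have "continuous_map Y T (f \<circ> i)"
    using i f(1) continuous_map_compose by blast
  moreover have "(f \<circ> i) ` topspace Y = topspace T"
    using f(2) by (force simp: topY ie image_comp)
  ultimately show ?thesis unfolding analytic_space_def by blast
qed

definition analytic_group :: "('a, 'c) monoid_scheme \<Rightarrow> 'a topology \<Rightarrow> bool" where
  "analytic_group G T \<longleftrightarrow> topological_group G T \<and> Hausdorff_space T \<and> analytic_space T"

definition perfect_in :: "'a topology \<Rightarrow> 'a set \<Rightarrow> bool" where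
  "perfect_in T P \<longleftrightarrow>
     P \<subseteq> topspace T \<and> P \<noteq> {} \<and> completely_metrizable_space (subtopology T P) \<and>
     (\<forall>x\<in>P. \<not> openin (subtopology T P) {x})"

text \<open>Free groups. A word over \<open>S\<close> is a list of letters \<open>(x, b)\<close> with \<open>x \<in> S\<close>, where
  \<open>(x, True)\<close> stands for \<open>x\<close> and \<open>(x, False)\<close> for the inverse of \<open>x\<close>.\<close>

fun word_value :: "('a, 'c) monoid_scheme \<Rightarrow> ('a \<times> bool) list \<Rightarrow> 'a" where
  "word_value G [] = \<one>\<^bsub>G\<^esub>"
| "word_value G ((x, b) # w) = (if b then x else inv\<^bsub>G\<^esub> x) \<otimes>\<^bsub>G\<^esub> word_value G w"

definition reduced_words :: "'a set \<Rightarrow> ('a \<times> bool) list set" where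
  "reduced_words S =
     {w. fst ` set w \<subseteq> S \<and> successively (\<lambda>(x, b) (y, c). x = y \<longrightarrow> b = c) w}"

definition free_basis :: "('a, 'c) monoid_scheme \<Rightarrow> 'a set \<Rightarrow> bool" where
  "free_basis G S \<longleftrightarrow>
     S \<subseteq> carrier G \<and> (\<forall>g\<in>carrier G. \<exists>!w. w \<in> reduced_words S \<and> word_value G w = g)"

definition free_group :: "('a, 'c) monoid_scheme \<Rightarrow> bool" where
  "free_group G \<longleftrightarrow> group G \<and> (\<exists>S. free_basis G S)"

end

theory Submission
  imports Defs
begin

text \<open>
  Freeness is an open condition, and this makes the dichotomy elementary. Let \<open>S\<close> be a free basis
  of an uncountable free subgroup; then \<open>S\<close> is uncountable, because only countably many reduced words
  exist over a countable alphabet. Let \<open>f\<close> be a continuous map from a Polish space onto \<open>G\<close>, and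
  choose one preimage of each element of \<open>S\<close>. After discarding countably many of these points, the
  remaining set \<open>A\<close> has no isolated points (\<open>uncountable_dense_in_itself_subset\<close>).

  A nonempty reduced word \<open>w\<close> in \<open>n\<close> variables defines an \<open>n\<close>-ary relation on the Polish space: the
  images under \<open>f\<close> do not satisfy the equation \<open>w = 1\<close>. As \<open>G\<close> is Hausdorff and the group operations
  are continuous, the relation is open, and it holds for all tuples of distinct points of \<open>A\<close>.
  There are only countably many words, so a Cantor scheme with centres in \<open>A\<close> can secure these
  relations one after another, each from some level on and on whole balls around the centres. Its
  limit is a continuous map \<open>c\<close> from the Cantor space such that every relation holds for the points
  that belong to distinct branches (\<open>Cantor_family_of_open_relations\<close>). This is the construction
  behind Mycielski's theorem on independent sets. The limit points need not belong to \<open>A\<close>; openness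
  carries the relations over to them.

  Consequently no nonempty reduced word in the points \<open>f (c a)\<close> is trivial. The word
  \<open>x y\<^sup>-\<^sup>1\<close> shows that \<open>f \<circ> c\<close> is injective; by compactness it is an embedding, so its range is a
  homeomorphic copy of the Cantor space, hence perfect, and it is a free basis of the subgroup that
  it generates.
\<close>

section \<open>Reduced words and free bases\<close>

abbreviation no_cancel :: "'a \<times> bool \<Rightarrow> 'a \<times> bool \<Rightarrow> bool" where
  "no_cancel \<equiv> \<lambda>(x, b) (y, c). x = y \<longrightarrow> b = c"

abbreviation inverse_word :: "('a \<times> bool) list \<Rightarrow> ('a \<times> bool) list" where
  "inverse_word w \<equiv> rev (map (apsnd Not) w)"

lemma Nil_in_reduced_words [simp]: "[] \<in> reduced_words S"
  by (simp add: reduced_words_def)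

lemma Cons_in_reduced_words:
  "l # w \<in> reduced_words S \<longleftrightarrow>
     fst l \<in> S \<and> w \<in> reduced_words S \<and> (w \<noteq> [] \<longrightarrow> no_cancel l (hd w))"
  by (auto simp: reduced_words_def successively_Cons)

text \<open>An injective renaming of the generators neither creates nor destroys cancellations. This allows
  words to be moved between the group, the Cantor space and a set of variables.\<close>

lemma reduced_words_map_iff:
  assumes "inj_on h (fst ` set w)"
  shows "map (apfst h) w \<in> reduced_words S \<longleftrightarrow> h ` fst ` set w \<subseteq> S \<and> w \<in> reduced_words UNIV"
proof -
  have "successively (\<lambda>l m. no_cancel (apfst h l) (apfst h m)) w \<longleftrightarrow> successively no_cancel w"
    using assms by (intro successively_cong) (auto simp: inj_on_def split_beta)
  then show ?thesis
    by (auto simp: reduced_words_def successively_map image_image)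
qed

lemma reduced_words_imp_UNIV: "w \<in> reduced_words S \<Longrightarrow> w \<in> reduced_words UNIV"
  by (simp add: reduced_words_def)

lemma append_in_reduced_words:
  "u @ v \<in> reduced_words S \<longleftrightarrow>
     u \<in> reduced_words S \<and> v \<in> reduced_words S \<and> (u = [] \<or> v = [] \<or> no_cancel (last u) (hd v))"
  by (auto simp: reduced_words_def successively_append_iff)

lemma inverse_word_in_reduced_words:
  assumes "w \<in> reduced_words S"
  shows "inverse_word w \<in> reduced_words S"
proof -
  have "successively (\<lambda>a b. no_cancel (apsnd Not b) (apsnd Not a)) w"
    using assms unfolding reduced_words_def
    by (auto intro: successively_mono[where P = no_cancel])
  then show ?thesis
    using assms by (simp add: reduced_words_def successively_map image_image)
qed

context group
begin

lemma word_value_closed [simp]: "fst ` set w \<subseteq> carrier G \<Longrightarrow> word_value G w \<in> carrier G"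
  by (induction w) auto

lemma word_value_append:
  assumes "fst ` set u \<subseteq> carrier G" "fst ` set v \<subseteq> carrier G"
  shows "word_value G (u @ v) = word_value G u \<otimes> word_value G v"
  using assms by (induction u) (auto simp: m_assoc)

lemma word_value_inverse_word:
  assumes "fst ` set w \<subseteq> carrier G"
  shows "word_value G (inverse_word w) = inv (word_value G w)"
  using assms
proof (induction w)
  case (Cons l w)
  obtain x b where l: "l = (x, b)" by fastforce
  have x: "x \<in> carrier G" and w: "fst ` set w \<subseteq> carrier G"
    using Cons.prems by (auto simp: l)
  have "fst ` set (inverse_word w) \<subseteq> carrier G"
    using w by (auto simp: image_image)
  then have "word_value G (inverse_word (l # w))
      = inv (word_value G w) \<otimes> word_value G [apsnd Not l]"
    using x Cons.IH[OF w] by (simp add: l word_value_append del: word_value.simps)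
  then show ?case
    using x w by (simp add: l inv_mult_group)
qed simp

lemma word_value_subgroup:
  assumes "subgroup H G" "fst ` set w \<subseteq> H"
  shows "word_value (G\<lparr>carrier := H\<rparr>) w = word_value G w"
  using assms(2) by (induction w) (auto simp: m_inv_consistent[OF assms(1)])

text \<open>Reduction proceeds from the right: a letter put in front of a reduced word either leaves it
  reduced or cancels against its first letter.\<close>

lemma ex_reduced_word:
  assumes "S \<subseteq> carrier G" "fst ` set w \<subseteq> S"
  shows "\<exists>v \<in> reduced_words S. word_value G v = word_value G w"
  using assms(2)
proof (induction w)
  case Nil
  then show ?case by (intro bexI[of _ "[]"]) auto
next
  case (Cons l w)
  then obtain v where v: "v \<in> reduced_words S" "word_value G v = word_value G w"
    by auto
  obtain x b where l: "l = (x, b)" by fastforce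
  have x: "x \<in> S" using Cons.prems by (simp add: l)
  show ?case
  proof (cases "l # v \<in> reduced_words S")
    case True
    then show ?thesis using v by (intro bexI[of _ "l # v"]) (auto simp: l)
  next
    case False
    then obtain v' where v': "v = (x, \<not> b) # v'"
      using v x by (cases v) (auto simp: Cons_in_reduced_words l)
    have "x \<in> carrier G" "fst ` set v' \<subseteq> carrier G"
      using v(1) x assms(1) by (auto simp: v' reduced_words_def)
    then have "word_value G v' = word_value G (l # v)"
      by (cases b) (simp_all add: v' l flip: m_assoc)
    then have "word_value G v' = word_value G (l # w)"
      using v(2) by (simp add: l)
    moreover have "v' \<in> reduced_words S"
      using v(1) by (simp add: v' Cons_in_reduced_words)
    ultimately show ?thesis by blast
  qed
qed

text \<open>After removal of the common prefix, two different reduced words \<open>u\<close> and \<open>v\<close> begin with different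
  letters, so that \<open>u\<^sup>-\<^sup>1 v\<close> is again reduced. If \<open>u\<close> and \<open>v\<close> had the same value,
  this would be a nonempty reduced word of value 1.\<close>

lemma reduced_word_unique:
  assumes "S \<subseteq> carrier G"
    and nontriv: "\<And>w. w \<in> reduced_words S \<Longrightarrow> w \<noteq> [] \<Longrightarrow> word_value G w \<noteq> \<one>"
    and "u \<in> reduced_words S" "v \<in> reduced_words S" "word_value G u = word_value G v"
  shows "u = v"
  using assms(3-)
proof (induction u arbitrary: v)
  case Nil
  then show ?case using nontriv[of v] by auto
next
  case (Cons l u)
  have "v \<noteq> []" using Cons.prems nontriv[of "l # u"] by auto
  then obtain m v' where v: "v = m # v'" by (cases v) auto
  have car: "fst ` set (l # u) \<subseteq> carrier G" "fst ` set v \<subseteq> carrier G"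
    using Cons.prems assms(1) by (auto simp: reduced_words_def)
  have "l = m"
  proof (rule ccontr)
    assume "l \<noteq> m"
    let ?w = "inverse_word (l # u) @ v"
    \<comment> \<open>the only place in the word where a cancellation could occur\<close>
    have "no_cancel (apsnd Not l) m"
      using \<open>l \<noteq> m\<close> by (auto simp: split_beta prod_eq_iff)
    then have "?w \<in> reduced_words S"
      using inverse_word_in_reduced_words[OF Cons.prems(1)] Cons.prems(2)
      by (simp add: append_in_reduced_words Cons_in_reduced_words v)
    moreover have "word_value G ?w = inv (word_value G (l # u)) \<otimes> word_value G v"
    proof -
      have "fst ` set (inverse_word (l # u)) \<subseteq> carrier G"
        using car(1) by (auto simp: image_image)
      then show ?thesis
        using car by (metis word_value_append word_value_inverse_word)
    qed
    then have "word_value G ?w = \<one>"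
      using car word_value_closed[OF car(2)] by (simp only: Cons.prems(3) l_inv)
    ultimately show False using nontriv[of ?w] by (simp add: v)
  qed
  moreover have "u = v'"
  proof (rule Cons.IH)
    obtain x b where m: "m = (x, b)" by fastforce
    have "x \<in> carrier G" using car by (simp add: m v)
    then show "word_value G u = word_value G v'"
      using Cons.prems(3) car by (auto simp: m v \<open>l = m\<close> split: if_splits)
  qed (use Cons.prems v in \<open>auto simp: Cons_in_reduced_words\<close>)
  ultimately show ?case by (simp add: v)
qed

lemma free_group_generateI:
  assumes S: "S \<subseteq> carrier G"
    and nontriv: "\<And>w. w \<in> reduced_words S \<Longrightarrow> w \<noteq> [] \<Longrightarrow> word_value G w \<noteq> \<one>"
  shows "free_group (G\<lparr>carrier := generate G S\<rparr>)"
proof -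
  have sub: "subgroup (generate G S) G" using S by (rule generate_is_subgroup)
  have incl: "S \<subseteq> generate G S" by (auto intro: generate.incl)
  have val: "word_value (G\<lparr>carrier := generate G S\<rparr>) w = word_value G w" if "w \<in> reduced_words S" for w
    by (rule word_value_subgroup[OF sub]) (use that incl in \<open>auto simp: reduced_words_def\<close>)
  have "\<exists>w. fst ` set w \<subseteq> S \<and> word_value G w = g" if "g \<in> generate G S" for g
    using that
  proof induction
    case one
    then show ?case by (intro exI[of _ "[]"]) auto
  next
    case (incl h)
    then show ?case using S by (intro exI[of _ "[(h, True)]"]) auto
  next
    case (inv h)
    then show ?case using S by (intro exI[of _ "[(h, False)]"]) auto
  next
    case (eng h1 h2)
    then obtain u v where
      "fst ` set u \<subseteq> S" "word_value G u = h1" "fst ` set v \<subseteq> S" "word_value G v = h2" by blast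
    then show ?case
      using S by (intro exI[of _ "u @ v"]) (auto simp: word_value_append subset_iff image_Un)
  qed
  then have ex: "\<exists>w. w \<in> reduced_words S \<and> word_value G w = g" if "g \<in> generate G S" for g
    using ex_reduced_word[OF S] that by metis
  have "\<exists>!w. w \<in> reduced_words S \<and> word_value (G\<lparr>carrier := generate G S\<rparr>) w = g"
    if "g \<in> generate G S" for g
  proof (rule ex_ex1I)
    show "\<exists>w. w \<in> reduced_words S \<and> word_value (G\<lparr>carrier := generate G S\<rparr>) w = g"
      using ex[OF that] val by auto
    show "u = v"
      if "u \<in> reduced_words S \<and> word_value (G\<lparr>carrier := generate G S\<rparr>) u = g"
        "v \<in> reduced_words S \<and> word_value (G\<lparr>carrier := generate G S\<rparr>) v = g" for u v
      using that val by (intro reduced_word_unique[OF S nontriv]) auto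
  qed
  then have "free_basis (G\<lparr>carrier := generate G S\<rparr>) S"
    using incl by (simp add: free_basis_def)
  then show ?thesis
    using subgroup_imp_group[OF sub] by (auto simp: free_group_def)
qed

lemma free_basis_nontrivial_word:
  assumes H: "subgroup H G" and S: "free_basis (G\<lparr>carrier := H\<rparr>) S"
    and w: "w \<in> reduced_words S" "w \<noteq> []"
  shows "word_value G w \<noteq> \<one>"
proof
  let ?H = "G\<lparr>carrier := H\<rparr>"
  assume "word_value G w = \<one>"
  moreover have "fst ` set w \<subseteq> H"
    using w S by (auto simp: reduced_words_def free_basis_def)
  ultimately have "word_value ?H w = \<one>" "word_value ?H [] = \<one>"
    using word_value_subgroup[OF H] by simp_all
  moreover have "\<exists>!v. v \<in> reduced_words S \<and> word_value ?H v = \<one>"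
    using S subgroup.one_closed[OF H] by (simp add: free_basis_def)
  ultimately have "w = []"
    using w(1) Nil_in_reduced_words[of S] by blast
  with w(2) show False ..
qed

end

text \<open>Every element is the value of a word over the basis, and a countable basis admits only countably
  many words.\<close>

lemma countable_free_basis_imp_countable:
  assumes "free_basis G S" "countable S"
  shows "countable (carrier G)"
proof -
  have "reduced_words S \<subseteq> lists (S \<times> UNIV)"
    by (force simp: reduced_words_def)
  then have "countable (reduced_words S)"
    using assms(2) by (meson countable_SIGMA countable_lists countable_subset countableI_type)
  moreover have "carrier G \<subseteq> word_value G ` reduced_words S"
    using assms(1) by (auto simp: free_basis_def)
  ultimately show ?thesis by (meson countable_image countable_subset)
qed

section \<open>Cantor schemes for open relations\<close>

abbreviation cantor_space :: "(nat \<Rightarrow> bool) topology" where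
  "cantor_space \<equiv> product_topology (\<lambda>_. discrete_topology UNIV) UNIV"

abbreviation prefix_of :: "(nat \<Rightarrow> bool) \<Rightarrow> nat \<Rightarrow> bool list" where
  "prefix_of a n \<equiv> map a [0..<n]"

text \<open>Finitely many branches are separated on a sufficiently high level of the binary tree.\<close>

lemma eventually_inj_on_prefix_of:
  assumes "finite F"
  shows "\<forall>\<^sub>F n in sequentially. inj_on (\<lambda>a. prefix_of a n) F"
proof -
  have "\<forall>\<^sub>F n in sequentially. prefix_of a n = prefix_of b n \<longrightarrow> a = b" for a b
  proof (cases "a = b")
    case False
    then obtain m where "a m \<noteq> b m" by auto
    then have "prefix_of a n \<noteq> prefix_of b n" if "n \<ge> Suc m" for n
      using that by auto
    then show ?thesis unfolding eventually_sequentially by blast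
  qed simp
  then have "\<forall>\<^sub>F n in sequentially. \<forall>a\<in>F. \<forall>b\<in>F. prefix_of a n = prefix_of b n \<longrightarrow> a = b"
    using assms by (intro eventually_ball_finite ballI)
  then show ?thesis by (simp add: inj_on_def)
qed

lemma openin_cantor_space_cylinder: "openin cantor_space {b. prefix_of b n = prefix_of a n}"
proof -
  have "finite {i. i < n \<and> {a i} \<noteq> UNIV}"
    by (rule finite_subset[of _ "{..<n}"]) auto
  then have "openin cantor_space (\<Pi>\<^sub>E i\<in>UNIV. if i < n then {a i} else UNIV)"
    by (simp add: openin_PiE_gen if_distrib[of "\<lambda>A. A \<noteq> UNIV"] cong: if_cong)
  also have "(\<Pi>\<^sub>E i\<in>UNIV. if i < n then {a i} else UNIV) = {b. prefix_of b n = prefix_of a n}"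
    by (auto simp: PiE_iff split: if_splits)
  finally show ?thesis .
qed

lemma not_openin_cantor_space_singleton: "\<not> openin cantor_space {a}"
proof
  assume "openin cantor_space {a}"
  then obtain U where fin: "finite {i. U i \<noteq> (UNIV :: bool set)}" and a: "a \<in> PiE UNIV U" "PiE UNIV U \<subseteq> {a}"
    by (auto simp: openin_product_topology_alt)
  have "{i. U i \<noteq> (UNIV :: bool set)} \<noteq> UNIV"
    using fin by (metis infinite_UNIV_nat)
  then obtain n where n: "U n = UNIV" by auto
  have "a(n := \<not> a n) \<in> PiE UNIV U"
    using a(1) n by (auto simp: PiE_iff)
  then have "a(n := \<not> a n) = a" using a(2) by blast
  then show False by (metis fun_upd_same)
qed

context Metric_space
begin

text \<open>The families \<open>y\<close> all of whose members lie in the balls of radius \<open>r\<close> around the members of \<open>p\<close>;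
  only the values on \<open>I\<close> matter. Closed balls are used because the limit of a scheme lies in the
  closed balls of all levels.\<close>

definition close_family :: "'i set \<Rightarrow> ('i \<Rightarrow> 'a) \<Rightarrow> real \<Rightarrow> ('i \<Rightarrow> 'a) set" where
  "close_family I p r = {y. \<forall>i\<in>I. y i \<in> mcball (p i) r}"

lemma close_family_mono:
  assumes "r \<le> s"
  shows "close_family I p r \<subseteq> close_family I p s"
  using mcball_subset_concentric[OF assms] unfolding close_family_def by blast

text \<open>A relation of arbitrary finite arity is a predicate on lists. It is open if its restriction to
  the lists of length \<open>n\<close> is open in the \<open>n\<close>-th power of the space, for each \<open>n\<close>.\<close>

definition open_relation :: "('a list \<Rightarrow> bool) \<Rightarrow> bool" where
  "open_relation Q \<longleftrightarrow> (\<forall>n p. p ` {..<n} \<subseteq> M \<longrightarrow> Q (map p [0..<n]) \<longrightarrow>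
     (\<exists>r>0. \<forall>y \<in> close_family {..<n} p r. Q (map y [0..<n])))"

text \<open>Level \<open>n\<close> of the scheme assigns a ball with centre in \<open>A\<close> to each binary string of length \<open>n\<close>,
  with a common radius. The last conjunct is the property that survives in the limit: the
  relations numbered up to \<open>n\<close> hold for distinct balls, however points are chosen inside the balls.
  Disjointness of the balls keeps the centres distinct on the next level.\<close>

definition scheme_level :: "'a set \<Rightarrow> ('k::countable \<Rightarrow> 'a list \<Rightarrow> bool) \<Rightarrow> nat
    \<Rightarrow> (bool list \<Rightarrow> 'a) \<times> real \<Rightarrow> bool" where
  "scheme_level A R n = (\<lambda>(p, r).
     0 < r \<and> r \<le> inverse (Suc n) \<and> p ` {s. length s = n} \<subseteq> A \<and>
     disjoint_family_on (\<lambda>s. mcball (p s) r) {s. length s = n} \<and>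
     (\<forall>y \<in> close_family {s. length s = n} p r. \<forall>k ss. to_nat k \<le> n \<longrightarrow> distinct ss \<longrightarrow>
        set ss \<subseteq> {s. length s = n} \<longrightarrow> R k (map y ss)))"

text \<open>Openness speaks of the positions in a list; the points of a scheme are indexed by binary
  strings. An arbitrary index set covers the latter. In the form with a filter, finitely many
  requirements on the radius can be combined.\<close>

lemma open_relation_family:
  fixes p :: "'i \<Rightarrow> 'a"
  assumes Q: "open_relation Q" and ss: "set ss \<subseteq> I" and p: "p ` I \<subseteq> M" "Q (map p ss)"
  shows "\<forall>\<^sub>F r in at_right 0. \<forall>y \<in> close_family I p r. Q (map y ss)"
proof -
  let ?q = "\<lambda>(y :: 'i \<Rightarrow> 'a) i. y (ss ! i)"
  have map_eq: "map (?q y) [0..<length ss] = map y ss" for y :: "'i \<Rightarrow> 'a"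
    by (rule nth_equalityI) auto
  have "?q p ` {..<length ss} \<subseteq> M"
    using ss p(1) by (auto simp: subset_iff)
  moreover have "Q (map (?q p) [0..<length ss])"
    using p(2) by (simp only: map_eq)
  ultimately have "\<exists>r>0. \<forall>y \<in> close_family {..<length ss} (?q p) r. Q (map y [0..<length ss])"
    using Q unfolding open_relation_def by blast
  then obtain r where r: "r > 0"
    "\<And>y. y \<in> close_family {..<length ss} (?q p) r \<Longrightarrow> Q (map y [0..<length ss])"
    by blast
  have "\<forall>y \<in> close_family I p r'. Q (map y ss)" if "r' < r" for r'
  proof
    fix y assume y: "y \<in> close_family I p r'"
    have "?q y i \<in> mcball (?q p i) r" if "i < length ss" for i
    proof -
      have "ss ! i \<in> I" using ss that by (auto simp: subset_iff)
      then have "?q y i \<in> mcball (?q p i) r'" using y by (simp add: close_family_def)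
      then show ?thesis using mcball_subset_concentric[of r' r] \<open>r' < r\<close> by auto
    qed
    then have "?q y \<in> close_family {..<length ss} (?q p) r" by (simp add: close_family_def)
    then show "Q (map y ss)" using r(2)[of "?q y"] by (simp only: map_eq)
  qed
  then show ?thesis using r(1) by (auto simp: eventually_at_right_field)
qed

text \<open>For distinct centres in \<open>A\<close>, each requirement on a level holds for all sufficiently small radii,
  and there are only finitely many requirements: finitely many relations numbered up to
  \<open>n\<close>, finitely many lists of distinct strings, and finitely many pairs of balls to be disjoint.\<close>

lemma ex_scheme_level:
  fixes R :: "'k::countable \<Rightarrow> 'a list \<Rightarrow> bool"
  assumes A: "A \<subseteq> M" and R: "\<And>k. open_relation (R k)"
    and rel: "\<And>k xs. distinct xs \<Longrightarrow> set xs \<subseteq> A \<Longrightarrow> R k xs"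
    and p: "p ` {s. length s = n} \<subseteq> A" "inj_on p {s. length s = n}" and "e > 0"
  shows "\<exists>r\<le>e. scheme_level A R n (p, r)"
proof -
  let ?L = "{s :: bool list. length s = n}"
  have finL: "finite ?L" using finite_lists_length_eq[of "UNIV :: bool set" n] by simp
  have "\<forall>\<^sub>F r in at_right 0. \<forall>y \<in> close_family ?L p r. R k (map y ss)"
    if ss: "distinct ss" "set ss \<subseteq> ?L" for k ss
  proof (rule open_relation_family[OF R ss(2)])
    show "p ` ?L \<subseteq> M" using p A by blast
    show "R k (map p ss)"
      using ss p by (intro rel) (auto simp: distinct_map intro: inj_on_subset)
  qed
  then have "\<forall>\<^sub>F r in at_right 0. \<forall>k\<in>{k :: 'k. to_nat k \<le> n}. \<forall>ss\<in>{ss. distinct ss \<and> set ss \<subseteq> ?L}.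
      \<forall>y \<in> close_family ?L p r. R k (map y ss)"
  proof (intro eventually_ball_finite ballI)
    show "finite {k :: 'k. to_nat k \<le> n}"
      using finite_vimageI[of "{..n}" "to_nat :: 'k \<Rightarrow> nat"] by (simp add: vimage_def)
    show "finite {ss. distinct ss \<and> set ss \<subseteq> ?L}"
      using finite_subset_distinct[OF finL] by (rule finite_subset[rotated]) auto
  qed auto
  moreover have "\<forall>\<^sub>F r in at_right 0. \<forall>s\<in>?L. \<forall>t\<in>?L. s \<noteq> t \<longrightarrow> mcball (p s) r \<inter> mcball (p t) r = {}"
  proof (intro eventually_ball_finite ballI finL)
    fix s t assume st: "s \<in> ?L" "t \<in> ?L"
    show "\<forall>\<^sub>F r in at_right 0. s \<noteq> t \<longrightarrow> mcball (p s) r \<inter> mcball (p t) r = {}"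
    proof (cases "s = t")
      case False
      then have "p s \<noteq> p t" "p s \<in> M" "p t \<in> M" using p st A by (auto simp: inj_on_def)
      then have "d (p s) (p t) / 2 > 0" by simp
      moreover have "mcball (p s) r \<inter> mcball (p t) r = {}" if "r < d (p s) (p t) / 2" for r
      proof -
        have False if "x \<in> mcball (p s) r" "x \<in> mcball (p t) r" for x
          using that triangle[of "p s" x "p t"] \<open>r < d (p s) (p t) / 2\<close> by (auto simp: commute)
        then show ?thesis by blast
      qed
      ultimately show ?thesis unfolding eventually_at_right_field by blast
    qed simp
  qed
  moreover have "\<forall>\<^sub>F r in at_right 0. 0 < r \<and> r \<le> e \<and> r \<le> inverse (real (Suc n))"
    unfolding eventually_at_right_field using \<open>e > 0\<close>
    by (intro exI[of _ "min e (inverse (real (Suc n)))"]) auto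
  ultimately have "\<forall>\<^sub>F r in at_right 0. r \<le> e \<and> scheme_level A R n (p, r)"
    by eventually_elim (use p in \<open>auto simp: scheme_level_def disjoint_family_on_def\<close>)
  then show ?thesis
    using eventually_happens'[OF trivial_limit_at_right_real] by blast
qed

text \<open>One child of each string keeps the centre of its parent, the other one takes a second point of
  \<open>A\<close> close to it. This is where the absence of isolated points enters.\<close>

lemma scheme_level_Suc:
  fixes R :: "'k::countable \<Rightarrow> 'a list \<Rightarrow> bool"
  assumes A: "A \<subseteq> M" and dense: "\<And>x e. x \<in> A \<Longrightarrow> e > 0 \<Longrightarrow> \<exists>y\<in>A. y \<noteq> x \<and> d x y < e"
    and R: "\<And>k. open_relation (R k)"
    and rel: "\<And>k xs. distinct xs \<Longrightarrow> set xs \<subseteq> A \<Longrightarrow> R k xs"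
    and lev: "scheme_level A R n (p, r)"
  shows "\<exists>p' r'. scheme_level A R (Suc n) (p', r') \<and>
           (\<forall>s b. length s = n \<longrightarrow> mcball (p' (s @ [b])) r' \<subseteq> mcball (p s) r)"
proof -
  let ?L = "{s :: bool list. length s = n}"
  have r: "r > 0" and pA: "p ` ?L \<subseteq> A" and disj: "disjoint_family_on (\<lambda>s. mcball (p s) r) ?L"
    using lev by (auto simp: scheme_level_def)
  have "\<forall>s\<in>?L. \<exists>y. y \<in> A \<and> y \<noteq> p s \<and> d (p s) y < r / 2"
    using dense[of _ "r / 2"] pA r by (auto simp: image_subset_iff)
  then obtain q where q: "\<And>s. s \<in> ?L \<Longrightarrow> q s \<in> A \<and> q s \<noteq> p s \<and> d (p s) (q s) < r / 2"
    by metis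
  define p' where "p' s = (if last s then q else p) (butlast s)" for s
  have p': "p' (s @ [b]) \<in> A" "d (p s) (p' (s @ [b])) \<le> r / 2" if "s \<in> ?L" for s b
  proof -
    have "p s \<in> A" "p s \<in> M" using pA that A by auto
    then show "p' (s @ [b]) \<in> A" "d (p s) (p' (s @ [b])) \<le> r / 2"
      using q[OF that] r by (auto simp: p'_def)
  qed
  have near: "mcball (p' (s @ [b])) (r / 2) \<subseteq> mcball (p s) r" if "s \<in> ?L" for s b
    using p'[OF that, of b] pA that A
    by (intro mcball_subset) (auto simp: commute)
  have split: "\<exists>t b. s = t @ [b] \<and> t \<in> ?L" if "length s = Suc n" for s :: "bool list"
    using that by (cases s rule: rev_cases) auto
  have "p' ` {s. length s = Suc n} \<subseteq> A"
    using split p'(1) by fastforce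
  moreover have "inj_on p' {s. length s = Suc n}"
  proof (rule inj_onI, clarify)
    fix u v :: "bool list" assume uv: "length u = Suc n" "length v = Suc n" and eq: "p' u = p' v"
    obtain s b t c where st: "u = s @ [b]" "s \<in> ?L" "v = t @ [c]" "t \<in> ?L"
      using split[OF uv(1)] split[OF uv(2)] by blast
    have "p' (s @ [b]) \<in> mcball (p s) r" if "s \<in> ?L" for s b
    proof -
      have "p' (s @ [b]) \<in> mcball (p' (s @ [b])) (r / 2)"
        using p'(1)[OF that, of b] A r by (simp add: subset_iff)
      then show ?thesis using near[OF that] by blast
    qed
    then have "p' u \<in> mcball (p s) r" "p' v \<in> mcball (p t) r"
      using st by simp_all
    then have "p' u \<in> mcball (p s) r \<inter> mcball (p t) r" using eq by simp
    then have "s = t"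
      using disjoint_family_onD[OF disj st(2,4)] by blast
    then show "u = v"
      using eq q[of s] st by (auto simp: p'_def split: if_splits)
  qed
  ultimately have "\<exists>r'\<le>r / 2. scheme_level A R (Suc n) (p', r')"
    using r by (intro ex_scheme_level A R rel) simp_all
  then obtain r' where r': "r' \<le> r / 2" "scheme_level A R (Suc n) (p', r')"
    by blast
  then show ?thesis
    using near mcball_subset_concentric[OF r'(1)] by blast
qed

text \<open>A form of Mycielski's theorem: the balls along each branch shrink to a point by
  completeness. Given distinct branches and a relation, on some level the branches have distinct
  prefixes and the relation has already been taken into account, so it holds for the limit points,
  which lie in the balls of that level.\<close>

lemma Cantor_family_of_open_relations:
  fixes R :: "'k::countable \<Rightarrow> 'a list \<Rightarrow> bool"
  assumes "mcomplete"
    and A: "A \<subseteq> M" "A \<noteq> {}"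
    and dense: "\<And>x e. x \<in> A \<Longrightarrow> e > 0 \<Longrightarrow> \<exists>y\<in>A. y \<noteq> x \<and> d x y < e"
    and R: "\<And>k. open_relation (R k)"
    and rel: "\<And>k xs. distinct xs \<Longrightarrow> set xs \<subseteq> A \<Longrightarrow> R k xs"
  shows "\<exists>c. continuous_map cantor_space mtopology c \<and> (\<forall>k as. distinct as \<longrightarrow> R k (map c as))"
proof -
  obtain a0 where a0: "a0 \<in> A" using A by auto
  have "\<exists>r\<le>1. scheme_level A R 0 (\<lambda>_. a0, r)"
    using a0 by (intro ex_scheme_level A(1) R rel) (auto simp: inj_on_def)
  then have "\<exists>pr. scheme_level A R 0 pr" by blast
  moreover have "\<exists>pr'. scheme_level A R (Suc n) pr' \<and>
      (\<forall>s b. length s = n \<longrightarrow> mcball (fst pr' (s @ [b])) (snd pr') \<subseteq> mcball (fst pr s) (snd pr))"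
    if "scheme_level A R n pr" for n pr
  proof -
    have "scheme_level A R n (fst pr, snd pr)" using that by simp
    then have "\<exists>p' r'. scheme_level A R (Suc n) (p', r') \<and>
        (\<forall>s b. length s = n \<longrightarrow> mcball (p' (s @ [b])) r' \<subseteq> mcball (fst pr s) (snd pr))"
      by (intro scheme_level_Suc A(1) dense R rel)
    then show ?thesis by auto
  qed
  ultimately obtain F where lev: "\<And>n. scheme_level A R n (F n)"
    and nest: "\<And>n s b. length s = n \<Longrightarrow>
      mcball (fst (F (Suc n)) (s @ [b])) (snd (F (Suc n))) \<subseteq> mcball (fst (F n) s) (snd (F n))"
    using dependent_nat_choice[of "scheme_level A R"
      "\<lambda>n pr pr'. \<forall>s b. length s = n \<longrightarrow> mcball (fst pr' (s @ [b])) (snd pr') \<subseteq> mcball (fst pr s) (snd pr)"]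
    by metis
  define B where "B a n = mcball (fst (F n) (prefix_of a n)) (snd (F n))" for a n
  have rad: "0 < snd (F n)" "snd (F n) \<le> inverse (Suc n)" for n
    using lev[of n] by (auto simp: scheme_level_def split_beta)
  have centre: "fst (F n) (prefix_of a n) \<in> M" for a n
    using lev[of n] A(1) by (auto simp: scheme_level_def split_beta image_subset_iff subset_iff)
  have small: "\<exists>n. snd (F n) < e" if "e > 0" for e
    using reals_Archimedean[OF that] rad(2) by (meson le_less_trans)
  have "\<Inter> (range (B a)) \<noteq> {}" for a
  proof -
    have "decseq (B a)"
      using nest[of "prefix_of a _"] by (intro decseq_SucI) (auto simp: B_def)
    moreover have "\<exists>n x. B a n \<subseteq> mcball x e" if "e > 0" for e
      using small[OF that] mcball_subset_concentric[of "snd (F _)" e] unfolding B_def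
      by (meson less_imp_le)
    moreover have "B a n \<noteq> {}" for n
      using centre[of n a] rad(1)[of n] centre_in_mcball_iff[of "fst (F n) (prefix_of a n)" "snd (F n)"]
      unfolding B_def by (metis empty_iff less_imp_le)
    moreover have "closedin mtopology (B a n)" for n by (simp add: B_def)
    ultimately show ?thesis
      using \<open>mcomplete\<close>[unfolded mcomplete_nest, rule_format, of "B a"] by blast
  qed
  then have "\<forall>a. \<exists>x. \<forall>n. x \<in> B a n" by blast
  then obtain c where c: "\<And>a n. c a \<in> B a n" by metis
  have "continuous_map cantor_space mtopology c"
    unfolding continuous_map_to_metric
  proof (intro ballI allI impI)
    fix a and e :: real assume "e > 0"
    then obtain n where n: "snd (F n) < e / 2" using small[of "e / 2"] by auto
    have "c b \<in> mball (c a) e" if "prefix_of b n = prefix_of a n" for b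
    proof -
      let ?x = "fst (F n) (prefix_of a n)"
      have "c a \<in> mcball ?x (snd (F n))" "c b \<in> mcball ?x (snd (F n))"
        using c[of a n] c[of b n] that by (simp_all add: B_def)
      then show ?thesis
        using n triangle[of "c a" ?x "c b"] by (auto simp: commute)
    qed
    then show "\<exists>U. openin cantor_space U \<and> a \<in> U \<and> (\<forall>b\<in>U. c b \<in> mball (c a) e)"
      using openin_cantor_space_cylinder[of n a] by blast
  qed
  moreover have "R k (map c as)" if "distinct as" for k as
  proof -
    have "\<forall>\<^sub>F n in sequentially. inj_on (\<lambda>a. prefix_of a n) (set as) \<and> to_nat k \<le> n"
      by (intro eventually_conj eventually_inj_on_prefix_of eventually_ge_at_top) simp
    then obtain n where inj': "inj_on (\<lambda>a. prefix_of a n) (set as)" and n: "to_nat k \<le> n"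
      using eventually_happens'[OF sequentially_bot] by blast
    define pre where "pre = (\<lambda>a. prefix_of a n)"
    have inj: "inj_on pre (set as)" using inj' by (simp add: pre_def)
    \<comment> \<open>the limit points, placed at the prefixes of their branches; the other strings keep their centres\<close>
    define y where "y s = (if s \<in> pre ` set as then c (inv_into (set as) pre s) else fst (F n) s)" for s
    have y: "y (pre a) = c a" if "a \<in> set as" for a
      using that inj by (simp add: y_def)
    have "y s \<in> mcball (fst (F n) s) (snd (F n))" if s: "length s = n" for s
    proof (cases "s \<in> pre ` set as")
      case True
      then obtain a where a: "a \<in> set as" "s = pre a" by blast
      have "c a \<in> mcball (fst (F n) (pre a)) (snd (F n))"
        using c[of a n] by (simp add: B_def pre_def)
      then show ?thesis using y[OF a(1)] a(2) by simp
    next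
      case False
      have "fst (F n) s \<in> M"
        using lev[of n] A(1) s by (auto simp: scheme_level_def split_beta)
      then show ?thesis using False rad(1)[of n] by (simp add: y_def)
    qed
    then have "y \<in> close_family {s. length s = n} (fst (F n)) (snd (F n))"
      by (simp add: close_family_def)
    moreover have "distinct (map pre as)" "set (map pre as) \<subseteq> {s. length s = n}"
      using that inj by (auto simp: distinct_map pre_def)
    moreover have "\<forall>y \<in> close_family {s. length s = n} (fst (F n)) (snd (F n)). \<forall>k ss. to_nat k \<le> n \<longrightarrow>
        distinct ss \<longrightarrow> set ss \<subseteq> {s. length s = n} \<longrightarrow> R k (map y ss)"
      using lev[of n] by (simp add: scheme_level_def split_beta)
    ultimately have "R k (map y (map pre as))" using n by blast
    moreover have "map y (map pre as) = map c as" using y by simp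
    ultimately show ?thesis by (simp only:)
  qed
  ultimately show ?thesis by blast
qed

end

section \<open>Free subsets of analytic groups\<close>

text \<open>A continuous injection of a compact space into a Hausdorff space is an embedding, so the range
  inherits complete metrizability and the absence of isolated points from the Cantor space.\<close>

lemma perfect_in_range_cantor_space:
  assumes h: "continuous_map cantor_space T h" "inj h" and T: "Hausdorff_space T"
  shows "perfect_in T (range h)"
proof -
  let ?P = "subtopology T (range h)"
  have top: "topspace cantor_space = UNIV" by (simp add: PiE_UNIV_domain)
  have "compact_space cantor_space"
    by (simp add: compact_space_product_topology compact_space_discrete_topology)
  then have "embedding_map cantor_space T h"
    using h T by (intro continuous_imp_embedding_map) (auto simp: top)
  then have hom: "homeomorphic_map cantor_space ?P h"
    by (simp only: embedding_map_def top)
  have "completely_metrizable_space cantor_space"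
    by (simp add: completely_metrizable_space_product_topology completely_metrizable_space_discrete_topology)
  then have "completely_metrizable_space ?P"
    using hom homeomorphic_completely_metrizable_space homeomorphic_map_imp_homeomorphic_space by blast
  moreover have "\<not> openin ?P {h a}" for a
    using homeomorphic_map_openness[OF hom, of "{a}"] not_openin_cantor_space_singleton[of a]
    by (simp add: top)
  moreover have "range h \<subseteq> topspace T"
    using continuous_map_image_subset_topspace[OF h(1)] by (simp only: top)
  ultimately show ?thesis by (auto simp: perfect_in_def)
qed

text \<open>The points of \<open>S\<close> that are not condensation points lie in one of the countably many basic balls
  which meet \<open>S\<close> in a countable set. So there are only countably many of them, and their removal
  leaves uncountably many points of \<open>S\<close> near each remaining point.\<close>

lemma (in Metric_space) uncountable_dense_in_itself_subset:
  assumes sep: "separable_space mtopology" and S: "S \<subseteq> M" "uncountable S"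
  shows "\<exists>A. A \<subseteq> S \<and> uncountable A \<and> (\<forall>x\<in>A. \<forall>e>0. \<exists>y\<in>A. y \<noteq> x \<and> d x y < e)"
proof -
  obtain D where D: "countable D" "D \<subseteq> M" "Abstract_Topology.closure_of mtopology D = M"
    using sep by (auto simp: separable_space_def)
  \<comment> \<open>a countable base of the topology, given by a countable dense set\<close>
  define \<B> where "\<B> = (\<lambda>(z, q). mball z (real_of_rat q)) ` (D \<times> UNIV)"
  define N where "N = (\<Union>B \<in> {B \<in> \<B>. countable (S \<inter> B)}. S \<inter> B)"
  have "countable \<B>" using D(1) by (simp add: \<B>_def)
  then have "countable {B \<in> \<B>. countable (S \<inter> B)}" by (rule countable_subset[rotated]) blast
  then have N: "countable N" unfolding N_def by (rule countable_UN) blast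
  have dense: "\<exists>y\<in>S - N. y \<noteq> x \<and> d x y < e" if x: "x \<in> S - N" and "e > 0" for x e
  proof -
    have "x \<in> M" using x S(1) by blast
    then have "\<exists>z\<in>D. z \<in> mball x r" if "r > 0" for r
      using that D(3) unfolding metric_closure_of by blast
    from this[OF half_gt_zero[OF \<open>e > 0\<close>]]
    obtain z where z: "z \<in> D" "z \<in> M" "d x z < e / 2" by auto
    then obtain q where q: "d x z < real_of_rat q" "real_of_rat q < e / 2"
      using of_rat_dense by blast
    define B where "B = mball z (real_of_rat q)"
    have B: "B \<in> \<B>" "x \<in> B"
      using z q \<open>x \<in> M\<close> by (auto simp: \<B>_def B_def commute)
    then have "uncountable (S \<inter> B)" using x by (auto simp: N_def)
    then have "uncountable (S \<inter> B - insert x N)"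
      using N by (intro uncountable_minus_countable) simp_all
    then have "S \<inter> B - insert x N \<noteq> {}" by (metis countable_empty)
    then obtain y where y: "y \<in> S - N" "y \<noteq> x" "y \<in> B" by blast
    have "d x y < e"
      using y z q triangle[of x z y] \<open>x \<in> M\<close> by (auto simp: B_def)
    then show ?thesis using y by blast
  qed
  have "uncountable (S - N)" using S(2) N by (rule uncountable_minus_countable)
  moreover have "\<forall>x\<in>S - N. \<forall>e>0. \<exists>y\<in>S - N. y \<noteq> x \<and> d x y < e"
    by (intro ballI allI impI dense)
  ultimately show ?thesis by (intro exI[of _ "S - N"] conjI Diff_subset)
qed

text \<open>The value of a word depends continuously on its letters, in the form that provides a common
  radius for all letters. The induction on the word is over all open sets \<open>V\<close>: by
  continuity of the multiplication, \<open>V\<close> contains a product of an open set around the first letter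
  and one around the value of the remaining word.\<close>

lemma (in Metric_space) word_value_in_open:
  assumes G: "topological_group G T" and f: "continuous_map mtopology T f"
    and p: "p ` I \<subseteq> M" and w: "fst ` set w \<subseteq> I"
    and V: "openin T V" "word_value G (map (apfst (\<lambda>i. f (p i))) w) \<in> V"
  shows "\<exists>r>0. \<forall>y \<in> close_family I p r. word_value G (map (apfst (\<lambda>i. f (y i))) w) \<in> V"
  using w V
proof (induction w arbitrary: V)
  case Nil
  then show ?case by (auto intro: exI[of _ 1])
next
  case (Cons l w)
  interpret group G using G by (simp add: topological_group_def)
  have top: "topspace T = carrier G" using G by (simp add: topological_group_def)
  obtain i b where l: "l = (i, b)" by fastforce
  define g where "g = (\<lambda>x. if b then f x else inv\<^bsub>G\<^esub> (f x))"
  have g: "continuous_map mtopology T g"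
    using f G continuous_map_compose[OF f, of T "\<lambda>x. inv\<^bsub>G\<^esub> x"]
    by (cases b) (auto simp: topological_group_def o_def g_def)
  have i: "i \<in> I" "p i \<in> M" using Cons.prems p by (auto simp: l)
  have fp: "f (p j) \<in> carrier G" if "j \<in> I" for j
    using f p that top by (auto simp: continuous_map_def Pi_iff)
  let ?v = "word_value G (map (apfst (\<lambda>i. f (p i))) w)"
  have v: "?v \<in> carrier G"
    using Cons.prems(1) fp by (intro word_value_closed) auto
  have gp: "g (p i) \<in> carrier G" using fp i by (auto simp: g_def)
  define U where "U = {z \<in> topspace (prod_topology T T). (\<lambda>(x, y). x \<otimes>\<^bsub>G\<^esub> y) z \<in> V}"
  have "openin (prod_topology T T) U"
    unfolding U_def using G Cons.prems(2) by (intro openin_continuous_map_preimage) (auto simp: topological_group_def)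
  have "(g (p i), ?v) \<in> U"
    using Cons.prems(3) v gp by (auto simp: l top U_def g_def)
  then have "\<exists>V1 V2. openin T V1 \<and> openin T V2 \<and> g (p i) \<in> V1 \<and> ?v \<in> V2 \<and> V1 \<times> V2 \<subseteq> U"
    using \<open>openin (prod_topology T T) U\<close> by (simp only: openin_prod_topology_alt)
  then obtain V1 V2 where V12: "openin T V1" "openin T V2" "g (p i) \<in> V1" "?v \<in> V2"
    "V1 \<times> V2 \<subseteq> U"
    by blast
  have "openin mtopology {x \<in> M. g x \<in> V1}"
    using openin_continuous_map_preimage[OF g V12(1)] by simp
  then obtain r1 where r1: "r1 > 0" "mball (p i) r1 \<subseteq> {x \<in> M. g x \<in> V1}"
    using i V12(3) unfolding openin_mtopology by blast
  obtain r2 where r2: "r2 > 0"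
    "\<And>y. y \<in> close_family I p r2 \<Longrightarrow> word_value G (map (apfst (\<lambda>i. f (y i))) w) \<in> V2"
    using Cons.IH[OF _ V12(2,4)] Cons.prems(1) by auto
  \<comment> \<open>halved, because the closed ball has to fit into an open ball of radius \<open>r1\<close>\<close>
  define r where "r = min (r1 / 2) r2"
  have "word_value G (map (apfst (\<lambda>i. f (y i))) (l # w)) \<in> V" if y: "y \<in> close_family I p r" for y
  proof -
    have "y i \<in> mcball (p i) r" using y i by (simp add: close_family_def)
    then have "y i \<in> mball (p i) r1" using r1(1) by (auto simp: r_def)
    then have "g (y i) \<in> V1" using r1(2) by blast
    moreover have "word_value G (map (apfst (\<lambda>i. f (y i))) w) \<in> V2"
      using r2(2) y close_family_mono[of r r2] by (auto simp: r_def)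
    ultimately have "(g (y i), word_value G (map (apfst (\<lambda>i. f (y i))) w)) \<in> U"
      using V12(5) by blast
    then show ?thesis by (simp add: l U_def g_def)
  qed
  moreover have "r > 0" using r1 r2 by (simp add: r_def)
  ultimately show ?case by blast
qed

text \<open>The relation avoided is the equation \<open>w = 1\<close>. Words are taken over the positions in the list
  \<open>gs\<close>, so that there are only countably many of them, independently of the group. For a list too
  short for the variables of \<open>w\<close> the condition is void.\<close>

definition avoids_relation :: "('a, 'c) monoid_scheme \<Rightarrow> (nat \<times> bool) list \<Rightarrow> 'a list \<Rightarrow> bool" where
  "avoids_relation G w gs \<longleftrightarrow>
     (w \<in> reduced_words {..<length gs} \<longrightarrow> w \<noteq> [] \<longrightarrow> word_value G (map (apfst ((!) gs)) w) \<noteq> \<one>\<^bsub>G\<^esub>)"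

text \<open>In a Hausdorff group the complement of the identity is open.\<close>

lemma (in Metric_space) open_relation_avoids_relation:
  assumes G: "topological_group G T" and T: "Hausdorff_space T" and f: "continuous_map mtopology T f"
  shows "open_relation (\<lambda>xs. avoids_relation G w (map f xs))"
  unfolding open_relation_def
proof (intro allI impI)
  fix n p assume p: "p ` {..<n} \<subseteq> M" and Q: "avoids_relation G w (map f (map p [0..<n]))"
  have nth: "map (apfst ((!) (map f (map y [0..<n])))) w = map (apfst (\<lambda>i. f (y i))) w"
    if "w \<in> reduced_words {..<n}" for y
    using that by (auto simp: reduced_words_def)
  have iff: "avoids_relation G w (map f (map y [0..<n])) \<longleftrightarrow>
      (w \<in> reduced_words {..<n} \<longrightarrow> w \<noteq> [] \<longrightarrow> word_value G (map (apfst (\<lambda>i. f (y i))) w) \<noteq> \<one>\<^bsub>G\<^esub>)" for y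
    using nth[of y]
    by (auto simp only: avoids_relation_def length_map length_upt minus_nat.diff_0)
  show "\<exists>r>0. \<forall>y \<in> close_family {..<n} p r. avoids_relation G w (map f (map y [0..<n]))"
  proof (cases "w \<in> reduced_words {..<n} \<and> w \<noteq> []")
    case True
    interpret group G using G by (simp add: topological_group_def)
    have top: "topspace T = carrier G" using G by (simp add: topological_group_def)
    let ?V = "topspace T - {\<one>\<^bsub>G\<^esub>}"
    have w: "fst ` set w \<subseteq> {..<n}" using True by (simp add: reduced_words_def)
    have "openin T ?V"
      using closedin_Hausdorff_singleton[OF T, of "\<one>\<^bsub>G\<^esub>"] top by (simp add: closedin_def)
    moreover have "word_value G (map (apfst (\<lambda>i. f (p i))) w) \<in> carrier G"
      using f p w top by (intro word_value_closed) (fastforce simp: continuous_map_def Pi_iff)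
    then have "word_value G (map (apfst (\<lambda>i. f (p i))) w) \<in> ?V"
      using Q True top iff[of p] by simp
    ultimately show ?thesis
      using word_value_in_open[OF G f p w, of ?V] unfolding iff by blast
  next
    case False
    then show ?thesis unfolding iff by (intro exI[of _ 1]) auto
  qed
qed

lemma avoids_relation_nontrivial:
  assumes nontriv: "\<And>w. w \<in> reduced_words S \<Longrightarrow> w \<noteq> [] \<Longrightarrow> word_value G w \<noteq> \<one>\<^bsub>G\<^esub>"
    and gs: "distinct gs" "set gs \<subseteq> S"
  shows "avoids_relation G w gs"
  unfolding avoids_relation_def
proof (intro impI)
  assume w: "w \<in> reduced_words {..<length gs}" "w \<noteq> []"
  then have sub: "fst ` set w \<subseteq> {..<length gs}" by (simp add: reduced_words_def)
  then have "(!) gs ` fst ` set w \<subseteq> S" using gs(2) nth_mem by blast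
  moreover have "inj_on ((!) gs) {..<length gs}" using gs(1) by (simp add: inj_on_nth)
  then have "inj_on ((!) gs) (fst ` set w)" using sub by (rule inj_on_subset)
  ultimately have "map (apfst ((!) gs)) w \<in> reduced_words S"
    using reduced_words_imp_UNIV[OF w(1)] by (simp add: reduced_words_map_iff)
  then show "word_value G (map (apfst ((!) gs)) w) \<noteq> \<one>\<^bsub>G\<^esub>"
    using nontriv w(2) by simp
qed

text \<open>The letters of \<open>w\<close> are finitely many distinct indices; numbering them turns \<open>w\<close> into a word over
  positions.\<close>

lemma nontrivial_word_of_avoids_relation:
  assumes rel: "\<And>w as. distinct as \<Longrightarrow> avoids_relation G w (map h as)"
    and w: "w \<in> reduced_words UNIV" "w \<noteq> []"
  shows "word_value G (map (apfst h) w) \<noteq> \<one>\<^bsub>G\<^esub>"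
proof -
  obtain as where as: "set as = fst ` set w" "distinct as"
    using finite_distinct_list[of "fst ` set w"] by auto
  let ?ix = "inv_into {..<length as} ((!) as)"
  have im: "(!) as ` {..<length as} = fst ` set w"
    unfolding as(1)[symmetric] by (auto simp: in_set_conv_nth)
  have ix: "?ix x < length as" "as ! ?ix x = x" if "x \<in> fst ` set w" for x
  proof -
    have x: "x \<in> (!) as ` {..<length as}" using that im by simp
    show "?ix x < length as" using inv_into_into[OF x] by simp
    show "as ! ?ix x = x" using f_inv_into_f[OF x] .
  qed
  let ?w = "map (apfst ?ix) w"
  have "inj_on ?ix (fst ` set w)"
    using inj_on_inv_into[of "fst ` set w" "(!) as" "{..<length as}"] im by simp
  moreover have "?ix ` fst ` set w \<subseteq> {..<length as}"
    using ix(1) by blast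
  ultimately have "?w \<in> reduced_words {..<length (map h as)}"
    using w by (simp add: reduced_words_map_iff)
  then have "word_value G (map (apfst ((!) (map h as))) ?w) \<noteq> \<one>\<^bsub>G\<^esub>"
    using rel[OF as(2), of ?w] w(2) by (simp add: avoids_relation_def)
  moreover have "map (apfst ((!) (map h as))) ?w = map (apfst h) w"
  proof -
    have "map h as ! ?ix x = h x" if "x \<in> fst ` set w" for x
      using ix[OF that] by simp
    then show ?thesis by (force simp: apfst_def map_prod_def)
  qed
  ultimately show ?thesis by (simp only: not_False_eq_True)
qed

theorem corollary3p3:
  fixes G :: "('a, 'c) monoid_scheme" and T :: "'a topology"
  assumes "analytic_group G T"
  shows "(\<forall>H. subgroup H G \<and> free_group (G\<lparr>carrier := H\<rparr>) \<longrightarrow> countable H) \<or>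
         (\<exists>P. perfect_in T P \<and> free_group (G\<lparr>carrier := generate G P\<rparr>))"
proof (cases "\<forall>H. subgroup H G \<and> free_group (G\<lparr>carrier := H\<rparr>) \<longrightarrow> countable H")
  case False
  then obtain H where H: "subgroup H G" "free_group (G\<lparr>carrier := H\<rparr>)" "uncountable H" by blast
  have top: "topological_group G T" and Haus: "Hausdorff_space T" and ana: "analytic_space T"
    using assms by (auto simp: analytic_group_def)
  interpret group G using top by (simp add: topological_group_def)
  have car: "topspace T = carrier G" using top by (simp add: topological_group_def)
  obtain S where basis: "free_basis (G\<lparr>carrier := H\<rparr>) S"
    using H(2) by (auto simp: free_group_def)
  have S: "S \<subseteq> carrier G" "uncountable S"
    using basis subgroup.subset[OF H(1)] countable_free_basis_imp_countable[OF basis] H(3)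
    by (auto simp: free_basis_def)
  obtain X :: "real topology" and f where X: "Polish_space X" and f: "continuous_map X T f"
    and onto: "f ` topspace X = topspace T"
    using ana by (auto simp: analytic_space_def)
  obtain M d where "Metric_space M d" and compl: "Metric_space.mcomplete M d"
    and Xd: "X = Metric_space.mtopology M d"
    using X by (auto simp: Polish_space_def completely_metrizable_space_def)
  interpret X: Metric_space M d by fact
  define g where "g = inv_into M f"
  have g: "g s \<in> M" "f (g s) = s" if "s \<in> S" for s
  proof -
    have s: "s \<in> f ` M" using that S(1) onto car Xd by auto
    show "g s \<in> M" "f (g s) = s"
      using inv_into_into[OF s] f_inv_into_f[OF s] by (simp_all add: g_def)
  qed
  have "inj_on g S" using g(2) by (rule inj_on_inverseI)
  then have "uncountable (g ` S)" using S(2) countable_image_inj_eq by blast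
  moreover have "g ` S \<subseteq> M" using g by blast
  moreover have "separable_space X.mtopology" using X by (simp add: Polish_space_def Xd)
  ultimately obtain A where A: "A \<subseteq> g ` S" "uncountable A"
    and dense: "\<And>x e. x \<in> A \<Longrightarrow> e > 0 \<Longrightarrow> \<exists>y\<in>A. y \<noteq> x \<and> d x y < e"
    using X.uncountable_dense_in_itself_subset by metis
  have fA: "inj_on f A" "f ` A \<subseteq> S"
  proof -
    have "g (f x) = x" "f x \<in> S" if "x \<in> A" for x
      using that A(1) g(2) by auto
    then show "inj_on f A" "f ` A \<subseteq> S" by (auto intro: inj_on_inverseI)
  qed
  have "\<exists>c. continuous_map cantor_space X.mtopology c \<and>
      (\<forall>w as. distinct as \<longrightarrow> avoids_relation G w (map f (map c as)))"
  proof (rule X.Cantor_family_of_open_relations[OF compl, where A = A])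
    show "A \<subseteq> M" "A \<noteq> {}" using A g by auto
    show "\<exists>y\<in>A. y \<noteq> x \<and> d x y < e" if "x \<in> A" "e > 0" for x e
      using that by (rule dense)
    show "X.open_relation (\<lambda>xs. avoids_relation G w (map f xs))" for w
      by (rule X.open_relation_avoids_relation[OF top Haus]) (use f Xd in simp)
    show "avoids_relation G w (map f xs)" if "distinct xs" "set xs \<subseteq> A" for w xs
    proof (rule avoids_relation_nontrivial)
      show "word_value G w \<noteq> \<one>\<^bsub>G\<^esub>" if "w \<in> reduced_words S" "w \<noteq> []" for w
        using free_basis_nontrivial_word[OF H(1) basis that] .
      show "distinct (map f xs)" using that fA(1) by (auto simp: distinct_map intro: inj_on_subset)
      show "set (map f xs) \<subseteq> S" using that fA(2) by auto
    qed
  qed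
  then obtain c where c: "continuous_map cantor_space X c"
    and rel: "\<And>w as. distinct as \<Longrightarrow> avoids_relation G w (map f (map c as))"
    unfolding Xd by blast
  define h where "h = f \<circ> c"
  have h: "continuous_map cantor_space T h"
    using continuous_map_compose[OF c f] by (simp add: h_def)
  have word: "word_value G (map (apfst h) w) \<noteq> \<one>\<^bsub>G\<^esub>" if "w \<in> reduced_words UNIV" "w \<noteq> []" for w
  proof (rule nontrivial_word_of_avoids_relation[OF _ that])
    show "avoids_relation G w (map h as)" if "distinct as" for w as
      using rel[OF that] by (simp add: h_def)
  qed
  have range: "range h \<subseteq> carrier G"
    using continuous_map_image_subset_topspace[OF h] by (simp add: car PiE_UNIV_domain)
  \<comment> \<open>the two-letter word \<open>x y\<^sup>-\<^sup>1\<close>\<close>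
  have "inj h"
  proof (rule injI, rule ccontr)
    fix a b assume "h a = h b" "a \<noteq> b"
    have "h b \<in> carrier G" using range by blast
    then have "word_value G (map (apfst h) [(a, True), (b, False)]) = \<one>\<^bsub>G\<^esub>"
      using \<open>h a = h b\<close> by simp
    moreover have "[(a, True), (b, False)] \<in> reduced_words UNIV"
      using \<open>a \<noteq> b\<close> by (simp add: Cons_in_reduced_words)
    ultimately show False using word by blast
  qed
  have "free_group (G\<lparr>carrier := generate G (range h)\<rparr>)"
  proof (rule free_group_generateI[OF range])
    fix w assume w: "w \<in> reduced_words (range h)" "w \<noteq> []"
    let ?u = "map (apfst (inv_into UNIV h)) w"
    have "map (apfst h) ?u = map id w"
      unfolding map_map
    proof (rule map_cong[OF refl])
      fix l assume "l \<in> set w"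
      then have "fst l \<in> range h" using w(1) by (auto simp: reduced_words_def)
      then show "(apfst h \<circ> apfst (inv_into UNIV h)) l = id l"
        by (cases l) (simp add: f_inv_into_f)
    qed
    then have hu: "map (apfst h) ?u = w" by simp
    have "inj_on h (fst ` set ?u)" using \<open>inj h\<close> by (rule inj_on_subset) simp
    then have "?u \<in> reduced_words UNIV"
      using reduced_words_map_iff[of h ?u "range h"] w(1) unfolding hu by blast
    then show "word_value G w \<noteq> \<one>\<^bsub>G\<^esub>"
      using word[of ?u] w(2) unfolding hu by blast
  qed
  then show ?thesis
    using perfect_in_range_cantor_space[OF h \<open>inj h\<close> Haus] by blast
qed simp

end
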